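(* For every square-summable sequence of complex numbers $a=(a_1,a_2,\ldots)$ it holds that \[\sum_{m=1}^\infty \sum_{n=1}^\infty a_m \overline{a_n}\, \frac{mn}{(\max(m,n))^3} \leq \frac{4}{3}\sum_{m=1}^\infty |a_m|^2,\] and the constant $4/3$ cannot be replaced by any smaller number.
   Context: A sequence of complex numbers $a=(a_1,a_2,\ldots)$ is square-summable if $\sum_{m=1}^\infty |a_m|^2<\infty$. That the constant cannot be replaced by any smaller number means that for every real $C<4/3$ there is a square-summable sequence of complex numbers for which the inequality with $4/3$ replaced by $C$ fails. *)

theory Defs
  imports Complex_Main
begin

text \<open>
  A sequence $a_1, a_2, \ldots$ is a function \<open>a :: nat \<Rightarrow> complex\<close> of which only the values
  at positive arguments matter: all series below run over \<open>Suc m\<close> and \<open>Suc n\<close>, so that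
  \<open>a 0\<close> is never used.
\<close>

definition square_summable :: "(nat \<Rightarrow> complex) \<Rightarrow> bool" where
  "square_summable a \<longleftrightarrow> summable (\<lambda>m. (cmod (a (Suc m)))\<^sup>2)"

definition sq_norm :: "(nat \<Rightarrow> complex) \<Rightarrow> real" where
  "sq_norm a = (\<Sum>m. (cmod (a (Suc m)))\<^sup>2)"

definition kernel :: "nat \<Rightarrow> nat \<Rightarrow> real" where
  "kernel m n = real m * real n / real (max m n) ^ 3"

definition form_term :: "(nat \<Rightarrow> complex) \<Rightarrow> nat \<Rightarrow> nat \<Rightarrow> complex" where
  "form_term a m n = a m * cnj (a n) * of_real (kernel m n)"

definition double_series_converges :: "(nat \<Rightarrow> complex) \<Rightarrow> bool" where
  "double_series_converges a \<longleftrightarrow>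
     (\<forall>m. summable (\<lambda>n. form_term a (Suc m) (Suc n))) \<and>
     summable (\<lambda>m. \<Sum>n. form_term a (Suc m) (Suc n))"

definition double_series :: "(nat \<Rightarrow> complex) \<Rightarrow> complex" where
  "double_series a = (\<Sum>m. \<Sum>n. form_term a (Suc m) (Suc n))"

end

theory Submission
  imports Defs "HOL-Analysis.Infinite_Sum" "HOL-Analysis.Harmonic_Numbers"
begin

text \<open>
  Write \<open>A\<^sub>N = \<Sum>m\<le>N. m a\<^sub>m\<close> and let \<open>S\<^sub>N\<close> be the part of the double series with \<open>m, n \<le> N\<close>.
  Passing from \<open>S\<^sub>k\<^sub>-\<^sub>1\<close> to \<open>S\<^sub>k\<close> adds an L-shaped border on which \<open>max m n = k\<close>, so
  \<open>S\<^sub>k - S\<^sub>k\<^sub>-\<^sub>1 = (\<bar>A\<^sub>k\<bar>\<^sup>2 - \<bar>A\<^sub>k\<^sub>-\<^sub>1\<bar>\<^sup>2) / k\<^sup>3\<close> (\<open>square_sum_Suc\<close>). Summation by parts turns the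
  inequality into a weighted Hardy inequality
  \<open>\<Sum>k. c\<^sub>k \<bar>A\<^sub>k\<bar>\<^sup>2 \<le> 4/3 \<Sum>k. \<bar>a\<^sub>k\<bar>\<^sup>2\<close> with \<open>c\<^sub>k = 1/k\<^sup>3 - 1/(k+1)\<^sup>3\<close>.

  The Hardy inequality is proved by an induction that carries a surplus: with
  \<open>v\<^sub>k = k (2k+3) (4k+3) / 16\<close>,
  \[ S_N + \Bigl(\frac{1}{v_N} - \frac{1}{(N+1)^3}\Bigr) |A_N|^2
     \le \frac{4}{3} \sum_{m \le N} |a_m|^2 . \]
  Because \<open>\<bar>A\<^sub>k\<bar> \<le> \<bar>A\<^sub>k\<^sub>-\<^sub>1\<bar> + k \<bar>a\<^sub>k\<bar>\<close>, the Cauchy--Schwarz inequality reduces the induction step to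
  \<open>(v\<^sub>k\<^sub>-\<^sub>1 + 3k\<^sup>2/4) (c\<^sub>k + 1/v\<^sub>k) \<le> 1\<close>, a polynomial inequality in \<open>k\<close> (\<open>hardy_weight_step\<close>).
  Applied to \<open>\<bar>a\<bar>\<close>, the bound on the \<open>S\<^sub>N\<close> gives absolute summability over all pairs, so the
  iterated series converges, its value is the limit of the real numbers \<open>S\<^sub>N\<close>, and the bound passes
  to the limit (\<open>square_sum_tendsto\<close>).

  For the optimality of \<open>4/3\<close>, truncate \<open>a\<^sub>m = 1/\<surd>m\<close> at \<open>M\<close>. Then \<open>A\<^sub>k \<ge> 2/3 k\<^sup>3\<^sup>/\<^sup>2\<close>, each
  border contributes at least \<open>4/(3k) - 1/k\<^sup>2\<close>, and the double series is at least
  \<open>4/3 H\<^sub>M - 2\<close>, where the harmonic number \<open>H\<^sub>M\<close> is the square norm and is unbounded.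
\<close>

section \<open>Square partial sums\<close>

text \<open>The sum \<open>S\<^sub>N\<close>: the part of the double series over the pairs of indices from 1 to \<open>N\<close>.\<close>

definition square_sum :: "(nat \<Rightarrow> complex) \<Rightarrow> nat \<Rightarrow> complex" where
  "square_sum a N = (\<Sum>m<N. \<Sum>n<N. form_term a (Suc m) (Suc n))"

text \<open>The number \<open>A\<^sub>N\<close>: the sum of \<open>m a\<^sub>m\<close> over the indices \<open>m\<close> from 1 to \<open>N\<close>.\<close>

definition weighted_sum :: "(nat \<Rightarrow> complex) \<Rightarrow> nat \<Rightarrow> complex" where
  "weighted_sum a N = (\<Sum>m<N. of_nat (Suc m) * a (Suc m))"

lemma weighted_sum_0 [simp]: "weighted_sum a 0 = 0"
  by (simp add: weighted_sum_def)

lemma weighted_sum_Suc: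
  "weighted_sum a (Suc N) = weighted_sum a N + of_nat (Suc N) * a (Suc N)"
  by (simp add: weighted_sum_def)

text \<open>The border \<open>max m n = N + 1\<close> completes \<open>\<bar>A\<^sub>N\<bar>\<^sup>2\<close> to \<open>\<bar>A\<^sub>N\<^sub>+\<^sub>1\<bar>\<^sup>2\<close>, up to the common factor.\<close>

lemma square_sum_Suc:
  "square_sum a (Suc N) = square_sum a N +
     of_real (((cmod (weighted_sum a (Suc N)))\<^sup>2 - (cmod (weighted_sum a N))\<^sup>2) / real (Suc N) ^ 3)"
proof -
  define c :: complex where "c = of_nat (Suc N)"
  define x where "x = a (Suc N)"
  define w where "w = weighted_sum a N"
  have c0: "c \<noteq> 0" and cc: "cnj c = c"
    by (simp_all add: c_def flip: of_nat_Suc)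
  have col: "(\<Sum>m<N. form_term a (Suc m) (Suc N)) = w * cnj x * c / c ^ 3"
  proof -
    have "form_term a (Suc m) (Suc N) = (of_nat (Suc m) * a (Suc m)) * (cnj x * c / c ^ 3)"
      if "m < N" for m
      using that by (simp add: form_term_def kernel_def max_def c_def x_def flip: of_nat_Suc)
    then have "(\<Sum>m<N. form_term a (Suc m) (Suc N)) = w * (cnj x * c / c ^ 3)"
      unfolding w_def weighted_sum_def sum_distrib_right by (intro sum.cong) auto
    then show ?thesis by (simp add: mult_ac)
  qed
  have row: "(\<Sum>n<N. form_term a (Suc N) (Suc n)) = x * cnj w * c / c ^ 3"
  proof -
    have "form_term a (Suc N) (Suc n) = cnj (of_nat (Suc n) * a (Suc n)) * (x * c / c ^ 3)"
      if "n < N" for n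
      using that by (simp add: form_term_def kernel_def max_def c_def x_def flip: of_nat_Suc)
    then have "(\<Sum>n<N. form_term a (Suc N) (Suc n)) = cnj w * (x * c / c ^ 3)"
      unfolding w_def weighted_sum_def cnj_sum sum_distrib_right by (intro sum.cong) auto
    then show ?thesis by (simp add: mult_ac)
  qed
  have corner: "form_term a (Suc N) (Suc N) = x * cnj x * c * c / c ^ 3"
    by (simp add: form_term_def kernel_def c_def x_def flip: of_nat_Suc)
  have "square_sum a (Suc N) = square_sum a N
      + (w * cnj x * c / c ^ 3 + x * cnj w * c / c ^ 3 + x * cnj x * c * c / c ^ 3)"
    by (simp add: square_sum_def sum.distrib col row corner algebra_simps)
  also have "w * cnj x * c / c ^ 3 + x * cnj w * c / c ^ 3 + x * cnj x * c * c / c ^ 3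
      = ((w + c * x) * cnj (w + c * x) - w * cnj w) / c ^ 3"
    by (simp add: cc algebra_simps add_divide_distrib diff_divide_distrib)
  also have "\<dots> = of_real (((cmod (w + c * x))\<^sup>2 - (cmod w)\<^sup>2) / real (Suc N) ^ 3)"
    unfolding of_real_divide of_real_diff complex_norm_square by (simp add: c_def)
  finally show ?thesis
    by (simp add: weighted_sum_Suc w_def c_def x_def)
qed

lemma square_sum_in_Reals: "square_sum a N \<in> \<real>"
proof (induction N)
  case 0
  then show ?case by (simp add: square_sum_def)
next
  case (Suc N)
  then show ?case unfolding square_sum_Suc by (intro Reals_add Reals_of_real)
qed

section \<open>The finite inequality\<close>

text \<open>
  The numbers \<open>v\<^sub>k\<close>. For a cubic polynomial, expanding the inequality of \<open>hardy_weight_step\<close> at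
  infinity forces the leading term \<open>k\<^sup>3/2\<close> and bounds the coefficient of \<open>k\<^sup>2\<close> by \<open>9/8\<close>. The other
  coefficients are such that \<open>v\<^sub>0 = 0\<close> and the inequality holds from \<open>k = 1\<close> on.
\<close>

definition hardy_weight :: "real \<Rightarrow> real" where
  "hardy_weight k = k * (2 * k + 3) * (4 * k + 3) / 16"

lemma hardy_weight_pos: "k > 0 \<Longrightarrow> hardy_weight k > 0"
  by (simp add: hardy_weight_def)

lemma hardy_weight_le_cube: "k \<ge> 0 \<Longrightarrow> hardy_weight k \<le> (k + 1) ^ 3"
  by (simp add: hardy_weight_def field_simps power3_eq_cube)

lemma hardy_weight_step:
  fixes k :: real
  assumes "k \<ge> 1"
  shows "(hardy_weight (k - 1) + 3 * k\<^sup>2 / 4) * (1 / k ^ 3 - 1 / (k + 1) ^ 3 + 1 / hardy_weight k) \<le> 1"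
proof -
  define B where "B = k ^ 3 * (k + 1) ^ 3 * ((2 * k + 3) * (4 * k + 3))"
  define A where "A = (3 * k\<^sup>2 + 3 * k + 1) * ((2 * k + 3) * (4 * k + 3)) + 16 * k\<^sup>2 * (k + 1) ^ 3"
  have B: "B > 0" using assms by (simp add: B_def)
  have nz: "k \<noteq> 0" "k + 1 \<noteq> 0" "2 * k + 3 \<noteq> 0" "4 * k + 3 \<noteq> 0" using assms by auto
  have eq: "1 / k ^ 3 - 1 / (k + 1) ^ 3 + 1 / hardy_weight k = A / B"
  proof -
    have "1 / k ^ 3 - 1 / (k + 1) ^ 3 = (3 * k\<^sup>2 + 3 * k + 1) / (k ^ 3 * (k + 1) ^ 3)"
      using nz by (simp add: field_simps) (simp add: algebra_simps power2_eq_square power3_eq_cube)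
    also have "\<dots> = (3 * k\<^sup>2 + 3 * k + 1) * ((2 * k + 3) * (4 * k + 3)) / B"
      using nz by (simp add: B_def)
    finally have 1: "1 / k ^ 3 - 1 / (k + 1) ^ 3 = \<dots>" .
    have "B = k\<^sup>2 * (k + 1) ^ 3 * (k * (2 * k + 3) * (4 * k + 3))"
      by (simp add: B_def power2_eq_square power3_eq_cube)
    moreover have "k\<^sup>2 * (k + 1) ^ 3 \<noteq> 0" using nz by simp
    ultimately have 2: "1 / hardy_weight k = 16 * k\<^sup>2 * (k + 1) ^ 3 / B"
      by (simp add: hardy_weight_def mult.assoc)
    show ?thesis unfolding 1 2 A_def by (simp add: add_divide_distrib)
  qed
  have lhs: "hardy_weight (k - 1) + 3 * k\<^sup>2 / 4 = (8 * k ^ 3 + 6 * k\<^sup>2 - 3 * k + 1) / 16"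
    by (simp add: hardy_weight_def field_simps power2_eq_square power3_eq_cube)
  have "(8 * k ^ 3 + 6 * k\<^sup>2 - 3 * k + 1) * A \<le> 16 * B"
  proof -
    define t where "t = k - 1"
    have k: "k = t + 1" and t: "t \<ge> 0" using assms by (simp_all add: t_def)
    have "16 * B - (8 * k ^ 3 + 6 * k\<^sup>2 - 3 * k + 1) * A
        = 4 + 191 * t + 445 * t ^ 2 + 415 * t ^ 3 + 176 * t ^ 4 + 28 * t ^ 5"
      unfolding A_def B_def k by algebra
    also have "\<dots> \<ge> 0" using t by simp
    finally show ?thesis by simp
  qed
  then show ?thesis
    unfolding eq lhs times_divide_times_eq using B by (intro divide_le_eq_1_pos[THEN iffD2]) auto
qed

text \<open>
  The Cauchy--Schwarz inequality in the form \<open>(y + z)\<^sup>2 \<le> (v + w) (y\<^sup>2/v + z\<^sup>2/w)\<close>. The degenerate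
  case \<open>v = 0\<close>, where division by zero yields zero, needs \<open>y = 0\<close>.
\<close>

lemma cauchy_schwarz_two:
  fixes y z v w :: real
  assumes "v \<ge> 0" "w > 0" "v = 0 \<Longrightarrow> y = 0"
  shows "(y + z)\<^sup>2 \<le> (v + w) * (y\<^sup>2 / v + z\<^sup>2 / w)"
proof (cases "v = 0")
  case True
  with assms show ?thesis by simp
next
  case False
  with assms have v: "v > 0" by simp
  have "(v + w) * (y\<^sup>2 / v + z\<^sup>2 / w) - (y + z)\<^sup>2 = (w * y - v * z)\<^sup>2 / (v * w)"
    using v assms(2) by (simp add: field_simps power2_eq_square)
  also have "\<dots> \<ge> 0" using v assms(2) by simp
  finally show ?thesis by simp
qed

text \<open>
  The coefficient of the surplus is negative only at \<open>N = 0\<close>, where \<open>1 / v\<^sub>0\<close> is zero by the convention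
  for division by zero; there \<open>A\<^sub>0 = 0\<close>.
\<close>

lemma square_sum_surplus:
  "Re (square_sum a N) +
     (1 / hardy_weight (real N) - 1 / (real N + 1) ^ 3) * (cmod (weighted_sum a N))\<^sup>2
   \<le> 4 / 3 * (\<Sum>m<N. (cmod (a (Suc m)))\<^sup>2)"
proof (induction N)
  case 0
  then show ?case by (simp add: square_sum_def)
next
  case (Suc N)
  define k where "k = real N + 1"
  have k1: "k \<ge> 1" by (simp add: k_def)
  define x where "x = cmod (weighted_sum a (Suc N))"
  define y where "y = cmod (weighted_sum a N)"
  define b where "b = cmod (a (Suc N))"
  define v where "v = hardy_weight (k - 1)"
  define r where "r = 1 / k ^ 3 - 1 / (k + 1) ^ 3 + 1 / hardy_weight k"
  have v0: "v \<ge> 0" by (simp add: v_def hardy_weight_def k_def)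
  \<comment> \<open>the weight of \<open>z = k \<bar>a\<^sub>k\<bar>\<close> that makes \<open>z\<^sup>2 / w\<close> equal to \<open>4/3 \<bar>a\<^sub>k\<bar>\<^sup>2\<close>\<close>
  have w0: "3 * k\<^sup>2 / 4 > 0" using k1 by simp
  have vy: "y = 0" if "v = 0"
  proof -
    have "N = 0" using that by (auto simp: v_def k_def hardy_weight_def)
    then show ?thesis by (simp add: y_def)
  qed
  have r0: "r \<ge> 0"
  proof -
    have "1 / (k + 1) ^ 3 \<le> 1 / k ^ 3" using k1 by (intro divide_left_mono power_mono) auto
    moreover have "1 / hardy_weight k > 0" using k1 hardy_weight_pos[of k] by simp
    ultimately show ?thesis by (simp add: r_def)
  qed
  have "x \<le> y + cmod (of_nat (Suc N) * a (Suc N))"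
    unfolding x_def y_def weighted_sum_Suc by (rule norm_triangle_ineq)
  also have "cmod (of_nat (Suc N) * a (Suc N)) = k * b"
    by (simp only: norm_mult norm_of_nat) (simp add: k_def b_def)
  finally have "x\<^sup>2 \<le> (y + k * b)\<^sup>2" by (intro power_mono) (auto simp: x_def)
  also have "\<dots> \<le> (v + 3 * k\<^sup>2 / 4) * (y\<^sup>2 / v + (k * b)\<^sup>2 / (3 * k\<^sup>2 / 4))"
    using v0 w0 vy by (rule cauchy_schwarz_two)
  also have "(k * b)\<^sup>2 / (3 * k\<^sup>2 / 4) = 4 / 3 * b\<^sup>2"
    using k1 by (simp add: power_mult_distrib)
  finally have "r * x\<^sup>2 \<le> r * ((v + 3 * k\<^sup>2 / 4) * (y\<^sup>2 / v + 4 / 3 * b\<^sup>2))"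
    using r0 by (rule mult_left_mono)
  also have "\<dots> = ((v + 3 * k\<^sup>2 / 4) * r) * (y\<^sup>2 / v + 4 / 3 * b\<^sup>2)" by simp
  also have "\<dots> \<le> 1 * (y\<^sup>2 / v + 4 / 3 * b\<^sup>2)"
    using hardy_weight_step[OF k1] v0
    by (intro mult_right_mono) (auto simp: v_def r_def)
  finally have key: "r * x\<^sup>2 \<le> y\<^sup>2 / v + 4 / 3 * b\<^sup>2" by simp
  have IH: "Re (square_sum a N) + (1 / v - 1 / k ^ 3) * y\<^sup>2 \<le> 4 / 3 * (\<Sum>m<N. (cmod (a (Suc m)))\<^sup>2)"
    using Suc.IH by (simp add: v_def k_def y_def)
  have Sk: "real (Suc N) = k" by (simp add: k_def)
  have "Re (square_sum a (Suc N)) = Re (square_sum a N) + (x\<^sup>2 - y\<^sup>2) / k ^ 3"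
    unfolding square_sum_Suc x_def y_def Sk by simp
  then have "Re (square_sum a (Suc N)) + (1 / hardy_weight k - 1 / (k + 1) ^ 3) * x\<^sup>2
      = Re (square_sum a N) + (1 / v - 1 / k ^ 3) * y\<^sup>2 + (r * x\<^sup>2 - y\<^sup>2 / v)"
    by (simp add: r_def algebra_simps diff_divide_distrib)
  also have "\<dots> \<le> 4 / 3 * (\<Sum>m<Suc N. (cmod (a (Suc m)))\<^sup>2)"
    using IH key unfolding sum.lessThan_Suc distrib_left b_def by linarith
  finally show ?case unfolding x_def Sk .
qed

lemma Re_square_sum_le:
  "Re (square_sum a N) \<le> 4 / 3 * (\<Sum>m<N. (cmod (a (Suc m)))\<^sup>2)"
proof (cases "N = 0")
  case True
  then show ?thesis by (simp add: square_sum_def)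
next
  case False
  then have "hardy_weight (real N) > 0" by (intro hardy_weight_pos) simp
  then have "1 / (real N + 1) ^ 3 \<le> 1 / hardy_weight (real N)"
    by (intro divide_left_mono hardy_weight_le_cube) auto
  then have "(1 / hardy_weight (real N) - 1 / (real N + 1) ^ 3) * (cmod (weighted_sum a N))\<^sup>2 \<ge> 0"
    by simp
  with square_sum_surplus[of a N] show ?thesis by linarith
qed

section \<open>Passage to the double series\<close>

lemma form_term_summable_on:
  assumes "square_summable a"
  shows "(\<lambda>(m, n). form_term a (Suc m) (Suc n)) summable_on UNIV"
proof -
  \<comment> \<open>the kernel is nonnegative, so the absolute values are the terms of the form at \<open>\<bar>a\<bar>\<close>\<close>
  define b where "b m = complex_of_real (cmod (a m))" for m
  define f where "f = (\<lambda>(m, n). form_term a (Suc m) (Suc n))"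
  have nf: "norm (f (m, n)) = Re (form_term b (Suc m) (Suc n))" for m n
  proof -
    have "kernel (Suc m) (Suc n) \<ge> 0" by (simp add: kernel_def)
    then show ?thesis by (simp add: f_def form_term_def b_def norm_mult)
  qed
  have "sum (\<lambda>p. norm (f p)) F \<le> 4 / 3 * sq_norm a" if F: "finite F" for F
  proof -
    obtain N where N: "fst ` F \<union> snd ` F \<subseteq> {..<N}"
      using F finite_nat_iff_bounded[of "fst ` F \<union> snd ` F"] by auto
    have "F \<subseteq> {..<N} \<times> {..<N}"
      using N by (force simp: mem_Times_iff)
    then have "sum (\<lambda>p. norm (f p)) F \<le> sum (\<lambda>p. norm (f p)) ({..<N} \<times> {..<N})"
      by (intro sum_mono2) auto
    also have "\<dots> = Re (square_sum b N)"
      unfolding square_sum_def Re_sum sum.cartesian_product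
      by (intro sum.cong) (auto simp: nf)
    also have "\<dots> \<le> 4 / 3 * (\<Sum>m<N. (cmod (b (Suc m)))\<^sup>2)" by (rule Re_square_sum_le)
    also have "(\<Sum>m<N. (cmod (b (Suc m)))\<^sup>2) \<le> sq_norm a"
      using assms unfolding sq_norm_def square_summable_def b_def
      by (simp add: sum_le_suminf)
    finally show ?thesis by simp
  qed
  then have "(\<lambda>p. norm (f p)) summable_on UNIV"
    by (intro nonneg_bdd_above_summable_on bdd_aboveI2[where M = "4 / 3 * sq_norm a"]) auto
  then show ?thesis
    unfolding f_def by (rule abs_summable_summable)
qed

lemma square_sum_tendsto:
  assumes "square_summable a"
  shows "double_series_converges a" "square_sum a \<longlonglongrightarrow> double_series a"
proof -
  define f where "f = (\<lambda>(m, n). form_term a (Suc m) (Suc n))"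
  obtain S where S: "(f has_sum S) (UNIV \<times> UNIV)"
    using form_term_summable_on[OF assms] by (auto simp: f_def summable_on_def)
  have inner: "((\<lambda>n. f (m, n)) has_sum (\<Sum>\<^sub>\<infinity>n. f (m, n))) UNIV" for m
  proof -
    have "(\<lambda>(m, n). form_term a (Suc m) (Suc n)) summable_on (UNIV \<times> UNIV)"
      using S by (auto simp: f_def summable_on_def)
    from summable_on_SigmaD1[OF this, of m] show ?thesis
      by (simp add: f_def has_sum_infsum)
  qed
  then have row: "(\<lambda>n. form_term a (Suc m) (Suc n)) sums (\<Sum>\<^sub>\<infinity>n. f (m, n))" for m
    using has_sum_imp_sums[OF inner[of m]] by (simp add: f_def)
  have "((\<lambda>m. \<Sum>\<^sub>\<infinity>n. f (m, n)) has_sum S) UNIV"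
    using S inner by (rule has_sum_SigmaD)
  then have "(\<lambda>m. \<Sum>\<^sub>\<infinity>n. f (m, n)) sums S" by (rule has_sum_imp_sums)
  then have outer: "(\<lambda>m. \<Sum>n. form_term a (Suc m) (Suc n)) sums S"
    using row by (simp add: sums_iff)
  show "double_series_converges a"
    using row outer by (auto simp: double_series_converges_def sums_iff)
  have "filterlim (\<lambda>N. {..<N::nat} \<times> {..<N::nat}) (finite_subsets_at_top UNIV) sequentially"
    unfolding filterlim_finite_subsets_at_top
  proof (intro allI impI)
    fix X :: "(nat \<times> nat) set"
    assume "finite X \<and> X \<subseteq> UNIV"
    then obtain M where M: "fst ` X \<union> snd ` X \<subseteq> {..<M}"
      using finite_nat_iff_bounded[of "fst ` X \<union> snd ` X"] by auto
    have "X \<subseteq> {..<N} \<times> {..<N}" if "N \<ge> M" for N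
      using M that by (force simp: mem_Times_iff)
    then show "\<forall>\<^sub>F N in sequentially.
        finite ({..<N} \<times> {..<N}) \<and> X \<subseteq> {..<N} \<times> {..<N} \<and> {..<N} \<times> {..<N} \<subseteq> UNIV"
      by (auto simp: eventually_sequentially)
  qed
  with S have "(\<lambda>N. sum f ({..<N} \<times> {..<N})) \<longlonglongrightarrow> S"
    unfolding has_sum_def UNIV_Times_UNIV by (rule filterlim_compose)
  moreover have "sum f ({..<N} \<times> {..<N}) = square_sum a N" for N
    by (simp add: square_sum_def f_def sum.cartesian_product)
  moreover have "double_series a = S"
    using outer by (simp add: double_series_def sums_iff)
  ultimately show "square_sum a \<longlonglongrightarrow> double_series a" by simp
qed

lemma double_series_real_le:
  assumes "square_summable a"
  shows "double_series a \<in> \<real>" "Re (double_series a) \<le> 4 / 3 * sq_norm a"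
proof -
  note lim = square_sum_tendsto(2)[OF assms]
  show "double_series a \<in> \<real>"
    by (rule closed_sequentially[OF closed_complex_Reals _ lim]) (rule square_sum_in_Reals)
  have "Re (square_sum a N) \<le> 4 / 3 * sq_norm a" for N
  proof -
    have "(\<Sum>m<N. (cmod (a (Suc m)))\<^sup>2) \<le> sq_norm a"
      using assms unfolding sq_norm_def square_summable_def by (simp add: sum_le_suminf)
    with Re_square_sum_le[of a N] show ?thesis by linarith
  qed
  then show "Re (double_series a) \<le> 4 / 3 * sq_norm a"
    using tendsto_Re[OF lim] by (intro LIMSEQ_le_const2) auto
qed

section \<open>Optimality of the constant\<close>

text \<open>The lower bound \<open>A\<^sub>N \<ge> 2/3 N\<^sup>3\<^sup>/\<^sup>2\<close> for \<open>a\<^sub>m = 1/\<surd>m\<close>, in which \<open>m a\<^sub>m = \<surd>m\<close>.\<close>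

lemma sum_sqrt_ge: "2 / 3 * (real N * sqrt (real N)) \<le> (\<Sum>m<N. sqrt (real (Suc m)))"
proof (induction N)
  case 0
  then show ?case by simp
next
  case (Suc N)
  define s where "s = sqrt (real (Suc N))"
  have "(real N - 1 / 2) * s \<le> real N * sqrt (real N)"
  proof (cases "N = 0")
    case True
    then show ?thesis by (simp add: s_def)
  next
    case False
    then have N: "real N \<ge> 1" by simp
    have "((real N - 1 / 2) * s)\<^sup>2 = (real N - 1 / 2)\<^sup>2 * (real N + 1)"
      by (simp add: s_def power_mult_distrib)
    also have "\<dots> \<le> (real N)\<^sup>2 * real N"
      using N by (simp add: power2_eq_square algebra_simps)
    also have "\<dots> = (real N * sqrt (real N))\<^sup>2" by (simp add: power_mult_distrib)
    finally show ?thesis by (rule power2_le_imp_le) simp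
  qed
  then have "real (Suc N) * s \<le> real N * sqrt (real N) + 3 / 2 * s"
    by (simp add: algebra_simps)
  then show ?case using Suc.IH by (simp add: s_def)
qed

text \<open>The term \<open>2 / (N + 1)\<close> makes room for the inverse squares lost at each border.\<close>

lemma square_sum_inv_sqrt_ge:
  fixes a :: "nat \<Rightarrow> complex"
  assumes a: "\<And>m. 1 \<le> m \<Longrightarrow> m \<le> M \<Longrightarrow> a m = of_real (1 / sqrt (real m))"
  assumes "N \<le> M"
  shows "Re (square_sum a N) \<ge> 4 / 3 * harm N - 2 + 2 / (real N + 1)"
  using \<open>N \<le> M\<close>
proof (induction N)
  case 0
  then show ?case by (simp add: square_sum_def harm_def)
next
  case (Suc N)
  define k where "k = real (Suc N)"
  have k1: "k \<ge> 1" by (simp add: k_def)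
  define T where "T = (\<lambda>N. \<Sum>m<N. sqrt (real (Suc m)))"
  have T: "weighted_sum a n = of_real (T n)" if "n \<le> Suc N" for n
  proof -
    have "of_nat (Suc m) * a (Suc m) = of_real (sqrt (real (Suc m)))" if "m < n" for m
    proof -
      have "a (Suc m) = of_real (1 / sqrt (real (Suc m)))"
        using \<open>m < n\<close> \<open>n \<le> Suc N\<close> Suc.prems by (intro a) auto
      then have "of_nat (Suc m) * a (Suc m) = of_real (real (Suc m) / sqrt (real (Suc m)))"
        by simp
      then show ?thesis by (simp only: real_div_sqrt of_nat_0_le_iff)
    qed
    then show ?thesis by (simp add: weighted_sum_def T_def)
  qed
  have TS: "T N = T (Suc N) - sqrt k" by (simp add: T_def k_def)
  have "T (Suc N) \<ge> 2 / 3 * (k * sqrt k)" unfolding T_def k_def by (rule sum_sqrt_ge)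
  then have "2 * sqrt k * T (Suc N) \<ge> 2 * sqrt k * (2 / 3 * (k * sqrt k))"
    using k1 by (intro mult_left_mono) auto
  also have "2 * sqrt k * (2 / 3 * (k * sqrt k)) = 4 / 3 * k\<^sup>2"
    using k1 by (simp add: power2_eq_square)
  finally have "(T (Suc N))\<^sup>2 - (T N)\<^sup>2 \<ge> 4 / 3 * k\<^sup>2 - k"
    unfolding TS using k1 by (simp add: power2_eq_square algebra_simps)
  then have "((T (Suc N))\<^sup>2 - (T N)\<^sup>2) / k ^ 3 \<ge> (4 / 3 * k\<^sup>2 - k) / k ^ 3"
    using k1 by (intro divide_right_mono) auto
  also have "(4 / 3 * k\<^sup>2 - k) / k ^ 3 = 4 / (3 * k) - 1 / k\<^sup>2"
    using k1 by (simp add: field_simps power2_eq_square power3_eq_cube)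
  finally have "Re (square_sum a (Suc N)) \<ge> Re (square_sum a N) + 4 / (3 * k) - 1 / k\<^sup>2"
    unfolding square_sum_Suc by (simp add: T k_def)
  moreover have "Re (square_sum a N) \<ge> 4 / 3 * harm N - 2 + 2 / k"
    using Suc by (simp add: k_def add.commute)
  moreover have "harm (Suc N) = harm N + 1 / k"
    by (simp add: harm_Suc k_def inverse_eq_divide)
  \<comment> \<open>telescoping majorant of the inverse squares: \<open>1/k\<^sup>2 \<le> 2 (1/k - 1/(k+1))\<close>\<close>
  moreover have "1 / k\<^sup>2 \<le> 2 / k - 2 / (k + 1)"
  proof -
    have "2 / k - 2 / (k + 1) = 2 / (k * (k + 1))"
      using k1 by (simp add: field_simps)
    also have "\<dots> \<ge> 2 / (k * (k + k))"
      using k1 by (intro divide_left_mono mult_left_mono) auto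
    finally show ?thesis by (simp add: power2_eq_square)
  qed
  moreover have "4 / (3 * k) = 4 / 3 * (1 / k)" by simp
  ultimately show ?case unfolding k_def[symmetric] by linarith
qed

lemma square_sum_eventually_const:
  assumes "\<And>m. m > M \<Longrightarrow> a m = 0" and "N \<ge> M"
  shows "square_sum a N = square_sum a M"
proof -
  have "m < M" if "a (Suc m) \<noteq> 0" for m
    using assms(1)[of "Suc m"] that by (cases "m < M") auto
  with \<open>N \<ge> M\<close> show ?thesis
    unfolding square_sum_def sum.cartesian_product
    by (intro sum.mono_neutral_right) (auto simp: form_term_def)
qed

lemma constant_optimal:
  assumes "C < 4 / 3"
  shows "\<exists>a. square_summable a \<and> \<not> Re (double_series a) \<le> C * sq_norm a"
proof -
  obtain M where M: "harm M > 2 / (4 / 3 - C)"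
    using filterlim_at_top_dense[THEN iffD1, OF harm_at_top, rule_format, of "2 / (4 / 3 - C)"]
    by (auto simp: eventually_sequentially)
  define a where "a m = (if m \<le> M then complex_of_real (1 / sqrt (real m)) else 0)" for m
  have "(\<lambda>m. (cmod (a (Suc m)))\<^sup>2) sums (\<Sum>m<M. (cmod (a (Suc m)))\<^sup>2)"
    by (rule sums_finite) (auto simp: a_def)
  also have "(\<Sum>m<M. (cmod (a (Suc m)))\<^sup>2) = (\<Sum>m<M. inverse (real (Suc m)))"
    by (intro sum.cong) (auto simp: a_def norm_divide power_divide inverse_eq_divide)
  also have "\<dots> = harm M"
    unfolding harm_def by (rule sum.reindex_bij_witness[of _ "\<lambda>k. k - 1" Suc]) auto
  finally have norm: "square_summable a" "sq_norm a = harm M"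
    by (auto simp: square_summable_def sq_norm_def sums_iff)
  have "square_sum a N = square_sum a M" if "N \<ge> M" for N
    using that by (intro square_sum_eventually_const) (auto simp: a_def)
  then have lim: "square_sum a \<longlonglongrightarrow> square_sum a M"
    by (intro tendsto_eventually eventually_sequentiallyI)
  have double: "double_series a = square_sum a M"
    by (rule LIMSEQ_unique[OF square_sum_tendsto(2)[OF norm(1)] lim])
  have "Re (square_sum a M) \<ge> 4 / 3 * harm M - 2 + 2 / (real M + 1)"
    by (rule square_sum_inv_sqrt_ge) (auto simp: a_def)
  moreover have "2 / (real M + 1) > 0" by simp
  moreover have "(4 / 3 - C) * harm M > 2"
    using M assms by (simp add: field_simps)
  ultimately have "\<not> Re (double_series a) \<le> C * sq_norm a"
    unfolding double norm(2) left_diff_distrib by linarith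
  with norm(1) show ?thesis by blast
qed

theorem theorem2:
  "(\<forall>a. square_summable a \<longrightarrow>
        double_series_converges a \<and> double_series a \<in> \<real> \<and>
        Re (double_series a) \<le> 4 / 3 * sq_norm a) \<and>
   (\<forall>C<4 / 3. \<exists>a. square_summable a \<and> \<not> Re (double_series a) \<le> C * sq_norm a)"
  using square_sum_tendsto(1) double_series_real_le constant_optimal by blast

end
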